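(* There is an algorithm which, given a graph $G$ (by adjacency lists) and two independent sets $A,B$ of $G$ of size $2$, decides whether there exists a token jumping transformation from $A$ to $B$ (i.e. whether $A$ and $B$ lie in the same connected component of $\mathcal{R}_2(G)$) in time $O(|V(G)|+|E(G)|)$.
   Context: All graphs are finite, simple and undirected. For a graph $G$ and an integer $k\geq 1$, the $k$-configuration graph $\mathcal{R}_k(G)$ is the graph whose vertices are the independent sets of $G$ of size exactly $k$, where two such independent sets $I,J$ are adjacent if and only if $|I\cap J|=k-1$ (one token jumps from a vertex to another vertex). A token jumping transformation from $A$ to $B$ is a path from $A$ to $B$ in $\mathcal{R}_k(G)$. *)

theory Defs
  imports Main "Graph_Theory.Pair_Digraph"
begin

section \<open>Token jumping\<close>

text \<open>
  Finite simple undirected graphs are rendered by the library locale \<^locale>\<open>pair_graph\<close>: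
  finite symmetric loop-free digraphs whose arcs are ordered pairs. An undirected edge is
  therefore represented by two opposite arcs, and is counted only once in \<open>uedges\<close>.
\<close>

definition uedges :: "'a pair_pre_digraph \<Rightarrow> 'a set set" where
  "uedges G = {{u, v} | u v. (u, v) \<in> parcs G}"

definition independent_set :: "'a pair_pre_digraph \<Rightarrow> 'a set \<Rightarrow> bool" where
  "independent_set G I \<longleftrightarrow> I \<subseteq> pverts G \<and> (\<forall>u\<in>I. \<forall>v\<in>I. (u, v) \<notin> parcs G)"

text \<open>The definition is meant for \<open>k \<ge> 1\<close>; then \<open>card I = k\<close> forces \<open>I\<close> to be finite.\<close>

definition config_graph :: "nat \<Rightarrow> 'a pair_pre_digraph \<Rightarrow> 'a set pair_pre_digraph" where
  "config_graph k G =
     (let S = {I. independent_set G I \<and> card I = k} in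
      \<lparr> pverts = S, parcs = {(I, J). I \<in> S \<and> J \<in> S \<and> card (I \<inter> J) = k - 1} \<rparr>)"

definition token_jumping_transformation ::
    "nat \<Rightarrow> 'a pair_pre_digraph \<Rightarrow> 'a set \<Rightarrow> ('a set \<times> 'a set) list \<Rightarrow> 'a set \<Rightarrow> bool" where
  "token_jumping_transformation k G A p B \<longleftrightarrow>
     pre_digraph.apath (with_proj (config_graph k G)) A p B"


section \<open>A unit-cost random access machine\<close>

text \<open>
  A machine state has registers and arrays, all holding natural numbers. A program is a
  structured command; it names a fixed finite number of registers and arrays, and array cells
  are addressed indirectly through registers, so every elementary command is a constant number
  of instructions of a conventional single-memory RAM (interleave the arrays).

  There is deliberately no addition or multiplication: numbers grow by at most one per
  time unit (lemma \<open>exec_bounded\<close>), so that a linear-time computation only ever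
  handles words of logarithmic length, and charging unit cost is legitimate.
\<close>

record mstate =
  reg :: "nat \<Rightarrow> nat"
  arr :: "nat \<Rightarrow> nat \<Rightarrow> nat"

datatype test =
    TEq nat nat
  | TLess nat nat

fun holds :: "test \<Rightarrow> mstate \<Rightarrow> bool" where
  "holds (TEq x y) s \<longleftrightarrow> reg s x = reg s y"
| "holds (TLess x y) s \<longleftrightarrow> reg s x < reg s y"

datatype com =
    Skip
  | Const nat nat       \<comment> \<open>\<open>Const x k\<close>: \<open>x := k\<close>\<close>
  | Copy nat nat        \<comment> \<open>\<open>Copy x y\<close>: \<open>x := y\<close>\<close>
  | Inc nat
  | Dec nat
  | Load nat nat nat    \<comment> \<open>\<open>Load x a i\<close>: \<open>x := a[i]\<close>\<close>
  | Store nat nat nat   \<comment> \<open>\<open>Store a i x\<close>: \<open>a[i] := x\<close>\<close>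
  | Seq com com
  | If test com com
  | While test com

definition set_reg :: "nat \<Rightarrow> nat \<Rightarrow> mstate \<Rightarrow> mstate" where
  "set_reg x v s = s\<lparr>reg := (reg s)(x := v)\<rparr>"

definition set_arr :: "nat \<Rightarrow> nat \<Rightarrow> nat \<Rightarrow> mstate \<Rightarrow> mstate" where
  "set_arr a i v s = s\<lparr>arr := (arr s)(a := (arr s a)(i := v))\<rparr>"

text \<open>\<open>exec c s t s'\<close>: started in \<open>s\<close>, \<open>c\<close> halts after exactly \<open>t\<close> time units in \<open>s'\<close>.\<close>

inductive exec :: "com \<Rightarrow> mstate \<Rightarrow> nat \<Rightarrow> mstate \<Rightarrow> bool" where
  Skip: "exec Skip s 1 s"
| Const: "exec (Const x k) s 1 (set_reg x k s)"
| Copy: "exec (Copy x y) s 1 (set_reg x (reg s y) s)"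
| Inc: "exec (Inc x) s 1 (set_reg x (reg s x + 1) s)"
| Dec: "exec (Dec x) s 1 (set_reg x (reg s x - 1) s)"
| Load: "exec (Load x a i) s 1 (set_reg x (arr s a (reg s i)) s)"
| Store: "exec (Store a i x) s 1 (set_arr a (reg s i) (reg s x) s)"
| Seq: "exec c1 s t1 s' \<Longrightarrow> exec c2 s' t2 s'' \<Longrightarrow> exec (Seq c1 c2) s (t1 + t2) s''"
| IfTrue: "holds b s \<Longrightarrow> exec c1 s t s' \<Longrightarrow> exec (If b c1 c2) s (1 + t) s'"
| IfFalse: "\<not> holds b s \<Longrightarrow> exec c2 s t s' \<Longrightarrow> exec (If b c1 c2) s (1 + t) s'"
| WhileFalse: "\<not> holds b s \<Longrightarrow> exec (While b c) s 1 s"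
| WhileTrue: "holds b s \<Longrightarrow> exec c s t1 s' \<Longrightarrow> exec (While b c) s' t2 s'' \<Longrightarrow>
    exec (While b c) s (1 + t1 + t2) s''"

inductive_cases exec_SkipE: "exec Skip s t s'"
inductive_cases exec_ConstE: "exec (Const x k) s t s'"
inductive_cases exec_CopyE: "exec (Copy x y) s t s'"
inductive_cases exec_IncE: "exec (Inc x) s t s'"
inductive_cases exec_DecE: "exec (Dec x) s t s'"
inductive_cases exec_LoadE: "exec (Load x a i) s t s'"
inductive_cases exec_StoreE: "exec (Store a i x) s t s'"
inductive_cases exec_SeqE: "exec (Seq c1 c2) s t s'"
inductive_cases exec_IfE: "exec (If b c1 c2) s t s'"
inductive_cases exec_WhileE: "exec (While b c) s t s'"

lemma exec_deterministic:
  "exec c s t s' \<Longrightarrow> exec c s u s'' \<Longrightarrow> u = t \<and> s'' = s'"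
proof (induction arbitrary: u s'' rule: exec.induct)
  case (Skip s)
  then show ?case by (rule exec_SkipE) simp
next
  case (Const x k s)
  then show ?case by (rule exec_ConstE) simp
next
  case (Copy x y s)
  then show ?case by (rule exec_CopyE) simp
next
  case (Inc x s)
  then show ?case by (rule exec_IncE) simp
next
  case (Dec x s)
  then show ?case by (rule exec_DecE) simp
next
  case (Load x a i s)
  then show ?case by (rule exec_LoadE) simp
next
  case (Store a i x s)
  then show ?case by (rule exec_StoreE) simp
next
  case (Seq c1 s t1 s1 c2 t2 s2)
  from Seq.prems show ?case
  proof (rule exec_SeqE)
    fix v1 r v2
    assume u: "u = v1 + v2" and 1: "exec c1 s v1 r" and 2: "exec c2 r v2 s''"
    have "v1 = t1 \<and> r = s1" by (rule Seq.IH(1)[OF 1])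
    with 2 have "v1 = t1" "exec c2 s1 v2 s''" by simp_all
    with u Seq.IH(2) show ?thesis by simp
  qed
next
  case (IfTrue b s c1 t s1 c2)
  from IfTrue.prems show ?case
    by (rule exec_IfE) (use IfTrue.hyps(1) IfTrue.IH in simp_all)
next
  case (IfFalse b s c2 t s1 c1)
  from IfFalse.prems show ?case
    by (rule exec_IfE) (use IfFalse.hyps(1) IfFalse.IH in simp_all)
next
  case (WhileFalse b s c)
  from WhileFalse.prems show ?case
    by (rule exec_WhileE) (use WhileFalse.hyps in simp_all)
next
  case (WhileTrue b s c t1 s1 t2 s2)
  from WhileTrue.prems show ?case
  proof (rule exec_WhileE)
    assume "\<not> holds b s"
    with WhileTrue.hyps(1) show ?thesis by simp
  next
    fix v1 r v2
    assume u: "u = Suc (v1 + v2)" and 1: "exec c s v1 r" and 2: "exec (While b c) r v2 s''"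
    have "v1 = t1 \<and> r = s1" by (rule WhileTrue.IH(1)[OF 1])
    with 2 have "v1 = t1" "exec (While b c) s1 v2 s''" by simp_all
    with u WhileTrue.IH(2) show ?thesis by simp
  qed
qed

definition bounded_by :: "nat \<Rightarrow> mstate \<Rightarrow> bool" where
  "bounded_by M s \<longleftrightarrow> (\<forall>x. reg s x \<le> M) \<and> (\<forall>a i. arr s a i \<le> M)"

primrec max_const :: "com \<Rightarrow> nat" where
  "max_const Skip = 0"
| "max_const (Const x k) = k"
| "max_const (Copy x y) = 0"
| "max_const (Inc x) = 0"
| "max_const (Dec x) = 0"
| "max_const (Load x a i) = 0"
| "max_const (Store a i x) = 0"
| "max_const (Seq c1 c2) = max (max_const c1) (max_const c2)"
| "max_const (If b c1 c2) = max (max_const c1) (max_const c2)"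
| "max_const (While b c) = max_const c"

lemma bounded_by_mono: "bounded_by M s \<Longrightarrow> M \<le> N \<Longrightarrow> bounded_by N s"
  unfolding bounded_by_def by (meson le_trans)

lemma bounded_by_set_reg: "bounded_by M s \<Longrightarrow> v \<le> M \<Longrightarrow> bounded_by M (set_reg x v s)"
  by (simp add: bounded_by_def set_reg_def)

lemma bounded_by_set_arr: "bounded_by M s \<Longrightarrow> v \<le> M \<Longrightarrow> bounded_by M (set_arr a i v s)"
  by (simp add: bounded_by_def set_arr_def)

lemma bounded_byD: "bounded_by M s \<Longrightarrow> reg s x \<le> M" "bounded_by M s \<Longrightarrow> arr s a i \<le> M"
  by (simp_all add: bounded_by_def)

lemma exec_bounded:
  "exec c s t s' \<Longrightarrow> bounded_by M s \<Longrightarrow> max_const c \<le> M \<Longrightarrow> bounded_by (M + t) s'"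
proof (induction arbitrary: M rule: exec.induct)
  case (Skip s)
  then show ?case by (simp add: bounded_by_mono)
next
  case (Const x k s)
  then show ?case by (simp add: bounded_by_set_reg bounded_by_mono)
next
  case (Copy x y s)
  then show ?case by (simp add: bounded_by_set_reg bounded_by_mono bounded_byD le_SucI)
next
  case (Inc x s)
  then show ?case by (simp add: bounded_by_set_reg bounded_by_mono bounded_byD)
next
  case (Dec x s)
  then have "reg s x - 1 \<le> M + 1" using bounded_byD(1)[of M s x] by linarith
  with Dec show ?case by (simp add: bounded_by_set_reg bounded_by_mono)
next
  case (Load x a i s)
  then show ?case by (simp add: bounded_by_set_reg bounded_by_mono bounded_byD le_SucI)
next
  case (Store a i x s)
  then show ?case by (simp add: bounded_by_set_arr bounded_by_mono bounded_byD le_SucI)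
next
  case (Seq c1 s t1 s' c2 t2 s'')
  then have "bounded_by (M + t1 + t2) s''" by simp
  then show ?case by (simp add: add.assoc)
next
  case (IfTrue b s c1 t s' c2)
  then have "bounded_by (M + t) s'" by simp
  then show ?case by (rule bounded_by_mono) simp
next
  case (IfFalse b s c2 t s' c1)
  then have "bounded_by (M + t) s'" by simp
  then show ?case by (rule bounded_by_mono) simp
next
  case (WhileFalse b s c)
  then show ?case by (simp add: bounded_by_mono)
next
  case (WhileTrue b s c t1 s' t2 s'')
  then have "bounded_by (M + t1 + t2) s''" by simp
  then show ?case by (rule bounded_by_mono) simp
qed


section \<open>Input by adjacency lists\<close>

text \<open>
  The vertices of an input graph are numbered \<open>0, \<dots>, n - 1\<close>; the neighbours of a vertex
  are listed without repetition in an arbitrary order.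
\<close>

definition adjacency_lists :: "nat pair_pre_digraph \<Rightarrow> nat list list \<Rightarrow> bool" where
  "adjacency_lists G adj \<longleftrightarrow>
     pverts G = {..<length adj} \<and>
     (\<forall>v < length adj. distinct (adj ! v) \<and> set (adj ! v) = {w. (v, w) \<in> parcs G})"

text \<open>
  Array 1 holds the concatenation of all adjacency lists, and array 0 the positions where they
  start: the list of \<open>v\<close> occupies the cells from \<open>arr 0 v\<close> up to, but excluding,
  \<open>arr 0 (v + 1)\<close> of array 1. Register 0 holds the number of vertices, registers 1 to 4 the
  two given pairs of vertices. Everything else is initially 0.
\<close>

definition input_state :: "nat list list \<Rightarrow> nat \<times> nat \<Rightarrow> nat \<times> nat \<Rightarrow> mstate" where
  "input_state adj p q =
     \<lparr> reg = (\<lambda>x. if x < 5 then [length adj, fst p, snd p, fst q, snd q] ! x else 0),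
       arr = (\<lambda>a i.
         if a = 0 \<and> i \<le> length adj then sum_list (map length (take i adj))
         else if a = 1 \<and> i < length (concat adj) then concat adj ! i
         else 0) \<rparr>"

text \<open>The answer is left in register 0: 1 for yes, 0 for no.\<close>

definition answers :: "mstate \<Rightarrow> bool \<Rightarrow> bool" where
  "answers s Q \<longleftrightarrow> reg s 0 = (if Q then 1 else 0)"

end

theory Submission
  imports Defs "HOL-Combinatorics.Transposition"
begin

text \<open>
  Independent sets of size 2 are the edges of the complement graph, and a jump replaces an edge
  by another one sharing an endpoint. Hence \<open>{a1, a2}\<close> can be transformed into \<open>{b1, b2}\<close> iff
  \<open>a1\<close> and \<open>b1\<close> are connected in the complement. Breadth-first search explores the complement
  in time linear in the size of the graph itself: processing \<open>v\<close>, one marks the neighbours of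
  \<open>v\<close> and scans the vertices not reached so far; each of them either enters the queue, which
  happens to it only once, or is a neighbour of \<open>v\<close> and is charged to the degree of \<open>v\<close>.
\<close>

section \<open>Total correctness with running time\<close>

text \<open>As \<open>exec\<close> is deterministic, one halting run satisfying \<open>Q\<close> is
  the only one; this is a weakest precondition for total correctness that also sees the running
  time.\<close>

definition runs :: "com \<Rightarrow> mstate \<Rightarrow> (nat \<Rightarrow> mstate \<Rightarrow> bool) \<Rightarrow> bool" where
  "runs c s Q \<longleftrightarrow> (\<exists>t s'. exec c s t s' \<and> Q t s')"

lemma runs_mono: "runs c s Q \<Longrightarrow> (\<And>t s'. Q t s' \<Longrightarrow> Q' t s') \<Longrightarrow> runs c s Q'"
  unfolding runs_def by blast

lemma runs_simps [simp]:
  "runs Skip s Q \<longleftrightarrow> Q 1 s"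
  "runs (Const x k) s Q \<longleftrightarrow> Q 1 (set_reg x k s)"
  "runs (Copy x y) s Q \<longleftrightarrow> Q 1 (set_reg x (reg s y) s)"
  "runs (Inc x) s Q \<longleftrightarrow> Q 1 (set_reg x (reg s x + 1) s)"
  "runs (Load x a i) s Q \<longleftrightarrow> Q 1 (set_reg x (arr s a (reg s i)) s)"
  "runs (Store a i x) s Q \<longleftrightarrow> Q 1 (set_arr a (reg s i) (reg s x) s)"
  unfolding runs_def
  by (auto intro: exec.intros[simplified] elim: exec_SkipE exec_ConstE exec_CopyE exec_IncE exec_LoadE exec_StoreE)

lemma runs_Seq [simp]:
  "runs (Seq c1 c2) s Q \<longleftrightarrow> runs c1 s (\<lambda>t1 s1. runs c2 s1 (\<lambda>t2. Q (t1 + t2)))"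
  unfolding runs_def by (blast intro: exec.Seq elim: exec_SeqE)

lemma runs_If [simp]:
  "runs (If b c1 c2) s Q \<longleftrightarrow> runs (if holds b s then c1 else c2) s (\<lambda>t. Q (1 + t))"
  unfolding runs_def plus_1_eq_Suc
  by (auto intro: exec.IfTrue[simplified] exec.IfFalse[simplified] elim!: exec_IfE)

text \<open>Every round pays for its test and its body out of \<open>pot\<close>, whose strict
  decrease also gives termination; the extra 1 is the final failing test.\<close>

lemma runs_While:
  fixes pot :: "mstate \<Rightarrow> nat"
  assumes "I s"
    and step: "\<And>s. I s \<Longrightarrow> holds b s \<Longrightarrow> runs c s (\<lambda>t s'. I s' \<and> 1 + t + pot s' \<le> pot s)"
  shows "runs (While b c) s (\<lambda>t s'. t \<le> 1 + pot s \<and> I s' \<and> \<not> holds b s')"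
  using \<open>I s\<close>
proof (induction "pot s" arbitrary: s rule: less_induct)
  case less
  show ?case
  proof (cases "holds b s")
    case True
    obtain t1 s1 where 1: "exec c s t1 s1" "I s1" "1 + t1 + pot s1 \<le> pot s"
      using step[OF less.prems True] unfolding runs_def by blast
    then obtain t2 s2 where "exec (While b c) s1 t2 s2" "t2 \<le> 1 + pot s1" "I s2" "\<not> holds b s2"
      using less.hyps[of s1] unfolding runs_def by auto
    with 1 True show ?thesis
      unfolding runs_def by (intro exI[of _ "1 + t1 + t2"] exI[of _ s2]) (auto intro: exec.WhileTrue[simplified])
  next
    case False
    with less.prems show ?thesis unfolding runs_def by (auto intro: exec.WhileFalse[simplified])
  qed
qed

lemma reg_arr_simps [simp]:
  "reg (set_reg x v s) = (reg s)(x := v)"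
  "arr (set_reg x v s) = arr s"
  "reg (set_arr a i v s) = reg s"
  "arr (set_arr a i v s) = (arr s)(a := (arr s a)(i := v))"
  by (simp_all add: set_reg_def set_arr_def)


section \<open>Searching the complement\<close>

definition init_loop :: com where
  "init_loop = While (TLess 5 0) (Seq (Store 2 5 5) (Inc 5))"

definition mark_loop :: com where
  "mark_loop = While (TLess 9 10) (Seq (Load 12 1 9) (Seq (Store 3 12 11) (Inc 9)))"

text \<open>An in-place partition: a vertex without the current mark (register 11) is swapped with
  the cell at register 6, just behind the queue, and so joins the queue; marked vertices stay behind
  it.\<close>

definition scan_loop :: com where
  "scan_loop = While (TLess 9 0)
     (Seq (Load 12 2 9) (Seq (Load 13 3 12)
     (Seq (If (TEq 13 11) Skip
            (Seq (Load 13 2 6) (Seq (Store 2 9 13) (Seq (Store 2 6 12) (Inc 6)))))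
     (Inc 9))))"

text \<open>
  Array 2 permutes the vertices: its first \<open>h\<close> cells (register 5) hold the finished vertices,
  the cells from \<open>h\<close> up to \<open>e\<close> (register 6) the queue, and the others the vertices not yet
  reached. Array 3 holds the marks; the mark left by \<open>v\<close> is \<open>v + 1\<close>, so marks are never erased.
  Register 7 tells whether the target in register 3 has been dequeued.
\<close>

definition search_loop :: com where
  "search_loop = While (TLess 5 6)
     (Seq (Load 8 2 5) (Seq (Inc 5) (Seq (If (TEq 8 3) (Const 7 1) Skip)
     (Seq (Load 9 0 8) (Seq (Copy 11 8) (Seq (Inc 11) (Seq (Load 10 0 11)
     (Seq mark_loop (Seq (Copy 9 6) scan_loop)))))))))"

text \<open>The two stores exchange cell 0 and the cell of the start vertex (register 1) in the
  identity permutation, so that the queue initially consists of that vertex alone.\<close>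

definition complement_search :: com where
  "complement_search =
     Seq init_loop (Seq (Const 5 0) (Seq (Store 2 1 5) (Seq (Store 2 5 1) (Seq (Const 6 1)
     (Seq search_loop (Copy 0 7))))))"

section \<open>Correctness and cost of the inner loops\<close>

lemma runs_init_loop:
  assumes "reg s 5 = 0"
  shows "runs init_loop s (\<lambda>t s'. t \<le> 1 + 3 * reg s 0 \<and> (\<forall>x. x \<noteq> 5 \<longrightarrow> reg s' x = reg s x) \<and>
    (\<forall>a. a \<noteq> 2 \<longrightarrow> arr s' a = arr s a) \<and> (\<forall>i < reg s 0. arr s' 2 i = i))"
proof -
  define I where "I \<sigma> \<longleftrightarrow> reg \<sigma> 5 \<le> reg s 0 \<and> (\<forall>x. x \<noteq> 5 \<longrightarrow> reg \<sigma> x = reg s x) \<and>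
    (\<forall>a. a \<noteq> 2 \<longrightarrow> arr \<sigma> a = arr s a) \<and> (\<forall>i < reg \<sigma> 5. arr \<sigma> 2 i = i)" for \<sigma> :: mstate
  have "runs init_loop s
      (\<lambda>t s'. t \<le> 1 + 3 * (reg s 0 - reg s 5) \<and> I s' \<and> \<not> holds (TLess 5 0) s')"
    unfolding init_loop_def
    by (rule runs_While[where pot = "\<lambda>\<sigma>. 3 * (reg s 0 - reg \<sigma> 5)"])
      (use assms in \<open>auto simp: I_def less_Suc_eq\<close>)
  then show ?thesis by (rule runs_mono) (auto simp: I_def assms)
qed

lemma runs_mark_loop:
  assumes "reg s 9 \<le> reg s 10"
  shows "runs mark_loop s (\<lambda>t s'. t \<le> 1 + 4 * (reg s 10 - reg s 9) \<and>
    (\<forall>x. x \<noteq> 9 \<and> x \<noteq> 12 \<longrightarrow> reg s' x = reg s x) \<and> (\<forall>a. a \<noteq> 3 \<longrightarrow> arr s' a = arr s a) \<and>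
    (\<forall>w. arr s' 3 w = (if w \<in> arr s 1 ` {reg s 9..<reg s 10} then reg s 11 else arr s 3 w)))"
proof -
  define I where "I \<sigma> \<longleftrightarrow> reg s 9 \<le> reg \<sigma> 9 \<and> reg \<sigma> 9 \<le> reg s 10 \<and>
    (\<forall>x. x \<noteq> 9 \<and> x \<noteq> 12 \<longrightarrow> reg \<sigma> x = reg s x) \<and> (\<forall>a. a \<noteq> 3 \<longrightarrow> arr \<sigma> a = arr s a) \<and>
    (\<forall>w. arr \<sigma> 3 w = (if w \<in> arr s 1 ` {reg s 9..<reg \<sigma> 9} then reg s 11 else arr s 3 w))" for \<sigma> :: mstate
  have "runs mark_loop s
      (\<lambda>t s'. t \<le> 1 + 4 * (reg s 10 - reg s 9) \<and> I s' \<and> \<not> holds (TLess 9 10) s')"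
    unfolding mark_loop_def
  \<comment> \<open>Four units per cell: test, load, store, increment.\<close>
  proof (rule runs_While[where pot = "\<lambda>\<sigma>. 4 * (reg s 10 - reg \<sigma> 9)"])
    fix \<sigma> assume I: "I \<sigma>" and "holds (TLess 9 10) \<sigma>"
    then have "{reg s 9..<Suc (reg \<sigma> 9)} = insert (reg \<sigma> 9) {reg s 9..<reg \<sigma> 9}"
      by (auto simp: I_def)
    with I \<open>holds (TLess 9 10) \<sigma>\<close>
    show "runs (Seq (Load 12 1 9) (Seq (Store 3 12 11) (Inc 9))) \<sigma>
      (\<lambda>t s'. I s' \<and> 1 + t + 4 * (reg s 10 - reg s' 9) \<le> 4 * (reg s 10 - reg \<sigma> 9))"
      by (auto simp: I_def)
  qed (use assms in \<open>auto simp: I_def\<close>)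
  then show ?thesis
  proof (rule runs_mono)
    fix t and s' :: mstate assume *: "t \<le> 1 + 4 * (reg s 10 - reg s 9) \<and> I s' \<and> \<not> holds (TLess 9 10) s'"
    then have "reg s' 9 = reg s 10" by (auto simp: I_def)
    with * show "t \<le> 1 + 4 * (reg s 10 - reg s 9) \<and>
      (\<forall>x. x \<noteq> 9 \<and> x \<noteq> 12 \<longrightarrow> reg s' x = reg s x) \<and> (\<forall>a. a \<noteq> 3 \<longrightarrow> arr s' a = arr s a) \<and>
      (\<forall>w. arr s' 3 w = (if w \<in> arr s 1 ` {reg s 9..<reg s 10} then reg s 11 else arr s 3 w))"
      by (simp add: I_def)
  qed
qed

text \<open>Exchanging two cells of an array precomposes it with a transposition; this keeps array 2
  a permutation.\<close>

lemma bij_betw_swap_values: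
  assumes "bij_betw f A A" "i \<in> A" "j \<in> A"
  shows "bij_betw (f(i := f j, j := f i)) A A"
proof -
  have "f(i := f j, j := f i) = f \<circ> transpose i j"
    by (auto simp: fun_eq_iff transpose_def)
  moreover have "bij_betw (transpose i j) A A"
    using assms by (simp add: bij_betw_transpose_iff)
  ultimately show ?thesis using assms(1) by (metis bij_betw_trans)
qed

text \<open>Beyond the old queue, the invariant cuts the array into three blocks: unmarked vertices
  up to register 6, marked ones up to register 9, and cells not yet scanned.\<close>

lemma runs_scan_loop:
  assumes "reg s 9 = reg s 6" "reg s 6 \<le> reg s 0" "bij_betw (arr s 2) {..<reg s 0} {..<reg s 0}"
  shows "runs scan_loop s (\<lambda>t s'. t \<le> 1 + 9 * (reg s 0 - reg s 6) \<and>
    (\<forall>x. x \<notin> {6, 9, 12, 13} \<longrightarrow> reg s' x = reg s x) \<and> (\<forall>a. a \<noteq> 2 \<longrightarrow> arr s' a = arr s a) \<and>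
    reg s 6 \<le> reg s' 6 \<and> reg s' 6 \<le> reg s 0 \<and>
    bij_betw (arr s' 2) {..<reg s 0} {..<reg s 0} \<and>
    (\<forall>i < reg s 6. arr s' 2 i = arr s 2 i) \<and>
    (\<forall>i \<in> {reg s 6..<reg s' 6}. arr s 3 (arr s' 2 i) \<noteq> reg s 11) \<and>
    (\<forall>i \<in> {reg s' 6..<reg s 0}. arr s 3 (arr s' 2 i) = reg s 11))"
proof -
  define I where "I \<sigma> \<longleftrightarrow> (\<forall>x. x \<notin> {6, 9, 12, 13} \<longrightarrow> reg \<sigma> x = reg s x) \<and>
    (\<forall>a. a \<noteq> 2 \<longrightarrow> arr \<sigma> a = arr s a) \<and>
    reg s 6 \<le> reg \<sigma> 6 \<and> reg \<sigma> 6 \<le> reg \<sigma> 9 \<and> reg \<sigma> 9 \<le> reg s 0 \<and>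
    bij_betw (arr \<sigma> 2) {..<reg s 0} {..<reg s 0} \<and>
    (\<forall>i < reg s 6. arr \<sigma> 2 i = arr s 2 i) \<and>
    (\<forall>i \<in> {reg s 6..<reg \<sigma> 6}. arr s 3 (arr \<sigma> 2 i) \<noteq> reg s 11) \<and>
    (\<forall>i \<in> {reg \<sigma> 6..<reg \<sigma> 9}. arr s 3 (arr \<sigma> 2 i) = reg s 11)" for \<sigma> :: mstate
  have "runs scan_loop s
      (\<lambda>t s'. t \<le> 1 + 9 * (reg s 0 - reg s 9) \<and> I s' \<and> \<not> holds (TLess 9 0) s')"
    unfolding scan_loop_def
  \<comment> \<open>At most nine units per cell: test, two loads, the conditional with up to four
    commands, increment.\<close>
  proof (rule runs_While[where pot = "\<lambda>\<sigma>. 9 * (reg s 0 - reg \<sigma> 9)"])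
    fix \<sigma> assume I: "I \<sigma>" and b: "holds (TLess 9 0) \<sigma>"
    then have lt: "reg \<sigma> 9 < reg s 0" "reg \<sigma> 6 < reg s 0" by (auto simp: I_def)
    have "bij_betw ((arr \<sigma> 2)(reg \<sigma> 9 := arr \<sigma> 2 (reg \<sigma> 6), reg \<sigma> 6 := arr \<sigma> 2 (reg \<sigma> 9)))
        {..<reg s 0} {..<reg s 0}"
      by (rule bij_betw_swap_values) (use I lt in \<open>auto simp: I_def\<close>)
    with I b lt show "runs (Seq (Load 12 2 9) (Seq (Load 13 3 12)
     (Seq (If (TEq 13 11) Skip
            (Seq (Load 13 2 6) (Seq (Store 2 9 13) (Seq (Store 2 6 12) (Inc 6)))))
     (Inc 9)))) \<sigma> (\<lambda>t s'. I s' \<and> 1 + t + 9 * (reg s 0 - reg s' 9) \<le> 9 * (reg s 0 - reg \<sigma> 9))"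
      by (auto simp: I_def less_Suc_eq)
  qed (use assms in \<open>auto simp: I_def\<close>)
  then show ?thesis by (rule runs_mono) (use assms in \<open>auto simp: I_def\<close>)
qed

section \<open>Breadth-first search in the complement\<close>

locale adjacency_arrays =
  fixes n :: nat and off cells :: "nat \<Rightarrow> nat"
  assumes off_mono: "v < n \<Longrightarrow> off v \<le> off (Suc v)"
begin

definition nbs :: "nat \<Rightarrow> nat set" where
  "nbs v = cells ` {off v..<off (Suc v)}"

text \<open>Counts cells rather than neighbours, since cells are what the marking loop pays
  for.\<close>

definition deg :: "nat \<Rightarrow> nat" where
  "deg v = off (Suc v) - off v"

definition co_adj :: "nat rel" where
  "co_adj = {(u, w). u < n \<and> w < n \<and> u \<noteq> w \<and> w \<notin> nbs u}"

lemma card_nbs_le: "card (nbs v) \<le> deg v"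
  unfolding nbs_def deg_def by (metis card_atLeastLessThan card_image_le finite_atLeastLessThan)

text \<open>The sum telescopes; monotone offsets make the truncated differences exact.\<close>

lemma sum_deg: "k \<le> n \<Longrightarrow> off 0 + (\<Sum>v<k. deg v) = off k"
proof (induction k)
  case (Suc k)
  then show ?case using off_mono[of k] by (simp add: deg_def)
qed simp

text \<open>
  Once the queue is empty, the edge clause says that the finished vertices are closed under
  adjacency in the complement.
\<close>

definition search_inv :: "nat \<Rightarrow> nat \<Rightarrow> mstate \<Rightarrow> bool" where
  "search_inv a b s \<longleftrightarrow> (let P = arr s 2; h = reg s 5; e = reg s 6 in
     reg s 0 = n \<and> reg s 3 = b \<and> arr s 0 = off \<and> arr s 1 = cells \<and>
     h \<le> e \<and> e \<le> n \<and> 0 < e \<and> P 0 = a \<and> bij_betw P {..<n} {..<n} \<and>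
     reg s 7 = (if b \<in> P ` {..<h} then 1 else 0) \<and>
     (\<forall>w v. arr s 3 w = Suc v \<longrightarrow> v \<in> P ` {..<h}) \<and>
     (\<forall>i<e. (a, P i) \<in> co_adj\<^sup>*) \<and>
     (\<forall>i<h. \<forall>j\<in>{e..<n}. P j \<in> nbs (P i)))"

text \<open>
  Processing \<open>v\<close> costs at most \<open>12 + 4 deg v\<close>, plus 9 per scanned cell; the cells scanned
  are those of the newly queued vertices and at most \<open>deg v\<close> others.
\<close>

definition search_pot :: "mstate \<Rightarrow> nat" where
  "search_pot s = 12 * (n - reg s 5) + 13 * ((\<Sum>v<n. deg v) - (\<Sum>i<reg s 5. deg (arr s 2 i))) +
     9 * (n - reg s 6)"

text \<open>The state \<open>s1\<close> is reached after the straight-line prefix of the loop body;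
  the 9 in the conclusion is the loop test plus the eight units of this prefix.\<close>

lemma search_step:
  assumes inv: "search_inv a b s" and lt: "reg s 5 < reg s 6"
    and s1: "reg s1 0 = reg s 0" "reg s1 3 = reg s 3" "reg s1 5 = Suc (reg s 5)" "reg s1 6 = reg s 6"
      "reg s1 7 = (if arr s 2 (reg s 5) = b then 1 else reg s 7)"
      "reg s1 9 = off (arr s 2 (reg s 5))" "reg s1 10 = off (Suc (arr s 2 (reg s 5)))"
      "reg s1 11 = Suc (arr s 2 (reg s 5))" "arr s1 = arr s"
  shows "runs (Seq mark_loop (Seq (Copy 9 6) scan_loop)) s1
    (\<lambda>t s'. search_inv a b s' \<and> 9 + t + search_pot s' \<le> search_pot s)"
proof -
  define P where "P = arr s 2"
  define h where "h = reg s 5"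
  define e where "e = reg s 6"
  define v where "v = P h"
  note defs = P_def h_def e_def v_def
  from inv have I: "reg s 0 = n" "reg s 3 = b" "arr s 0 = off" "arr s 1 = cells" "h < e" "e \<le> n"
    "P 0 = a" "bij_betw P {..<n} {..<n}" "reg s 7 = (if b \<in> P ` {..<h} then 1 else 0)"
    "\<And>w v. arr s 3 w = Suc v \<Longrightarrow> v \<in> P ` {..<h}"
    "\<And>i. i < e \<Longrightarrow> (a, P i) \<in> co_adj\<^sup>*"
    "\<And>i j. i < h \<Longrightarrow> j \<in> {e..<n} \<Longrightarrow> P j \<in> nbs (P i)"
    using lt unfolding search_inv_def Let_def defs by blast+
  have inj: "inj_on P {..<n}" using I(8) by (rule bij_betw_imp_inj_on)
  have vn: "v < n" using I unfolding v_def bij_betw_def by auto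
  have fresh: "v \<notin> P ` {..<h}"
    using inj I(5,6) unfolding v_def by (auto dest!: inj_onD)
  \<comment> \<open>All marks present come from finished vertices and \<open>v\<close> is not one of
    them, so stale marks cannot be mistaken for those of \<open>v\<close>.\<close>
  have marks: "arr s 3 w \<noteq> Suc v" for w using I(10) fresh by blast
  have "reg s1 9 \<le> reg s1 10" using off_mono[OF vn] by (simp add: s1 v_def defs)
  note mark = runs_mark_loop[OF this]
  show ?thesis unfolding runs_Seq
  proof (rule runs_mono[OF mark], elim conjE)
    fix t2 and s2 :: mstate
    assume t2: "t2 \<le> 1 + 4 * (reg s1 10 - reg s1 9)"
      and r2: "\<forall>x. x \<noteq> 9 \<and> x \<noteq> 12 \<longrightarrow> reg s2 x = reg s1 x"
      and a2: "\<forall>a. a \<noteq> 3 \<longrightarrow> arr s2 a = arr s1 a"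
      and m2: "\<forall>w. arr s2 3 w = (if w \<in> arr s1 1 ` {reg s1 9..<reg s1 10} then reg s1 11 else arr s1 3 w)"
    have t2: "t2 \<le> 1 + 4 * deg v" using t2 by (simp add: s1 deg_def defs)
    have m2: "arr s2 3 w = (if w \<in> nbs v then Suc v else arr s 3 w)" for w
      using m2 unfolding nbs_def s1 I defs by simp
    have marked: "arr s2 3 w = Suc v \<longleftrightarrow> w \<in> nbs v" for w using m2 marks by simp
    define s3 where "s3 = set_reg 9 (reg s2 6) s2"
    have s3: "reg s3 9 = e" "reg s3 6 = e" "reg s3 0 = n" "arr s3 2 = P" "reg s3 11 = Suc v"
      "arr s3 3 = arr s2 3" "arr s3 0 = off" "arr s3 1 = cells" "reg s3 3 = b" "reg s3 5 = Suc h"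
      "reg s3 7 = (if v = b then 1 else reg s 7)"
      using r2 a2 by (simp_all add: s3_def s1 I I(4)[simplified] flip: defs)
    have "runs scan_loop s3
      (\<lambda>t4 s4. search_inv a b s4 \<and> 9 + (t2 + (1 + t4)) + search_pot s4 \<le> search_pot s)"
    proof (rule runs_mono[OF runs_scan_loop], unfold s3)
      fix t4 and s4 :: mstate
      define P' where "P' = arr s4 2"
      define e' where "e' = reg s4 6"
      assume "t4 \<le> 1 + 9 * (n - e) \<and> (\<forall>x. x \<notin> {6, 9, 12, 13} \<longrightarrow> reg s4 x = reg s3 x) \<and>
        (\<forall>a. a \<noteq> 2 \<longrightarrow> arr s4 a = arr s3 a) \<and> e \<le> reg s4 6 \<and> reg s4 6 \<le> n \<and>
        bij_betw (arr s4 2) {..<n} {..<n} \<and> (\<forall>i<e. arr s4 2 i = P i) \<and>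
        (\<forall>i\<in>{e..<reg s4 6}. arr s2 3 (arr s4 2 i) \<noteq> Suc v) \<and>
        (\<forall>i\<in>{reg s4 6..<n}. arr s2 3 (arr s4 2 i) = Suc v)"
      then have t4: "t4 \<le> 1 + 9 * (n - e)"
        and r4: "\<And>x. x \<notin> {6, 9, 12, 13} \<Longrightarrow> reg s4 x = reg s3 x"
        and a4: "\<And>a. a \<noteq> 2 \<Longrightarrow> arr s4 a = arr s3 a"
        and e4: "e \<le> e'" "e' \<le> n" and bij: "bij_betw P' {..<n} {..<n}"
        and P': "\<And>i. i < e \<Longrightarrow> P' i = P i"
        and queued: "\<And>i. i \<in> {e..<e'} \<Longrightarrow> P' i \<notin> nbs v"
        and rest: "\<And>i. i \<in> {e'..<n} \<Longrightarrow> P' i \<in> nbs v"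
        unfolding P'_def e'_def marked by auto
      have inj': "inj_on P' {..<n}" using bij by (rule bij_betw_imp_inj_on)
      have finished: "P' ` {..<Suc h} = insert v (P ` {..<h})"
        using P' I(5) by (auto simp: v_def lessThan_Suc)
      \<comment> \<open>The scan fixes the cells below \<open>e\<close> and keeps the set of values,
        so it only permutes the cells from \<open>e\<close> on. This carries the edge clause for
        older vertices from \<open>P\<close> to \<open>P'\<close>.\<close>
      have rearranged: "\<exists>k\<in>{e..<n}. P' j = P k" if "j \<in> {e..<n}" for j
      proof -
        have "P' j \<in> P ` {..<n}" using that bij I(8) by (auto simp: bij_betw_def)
        then obtain k where k: "k < n" "P' j = P k" by auto
        have "\<not> k < e"
        proof
          assume "k < e"
          then have "P' j = P' k" using P' k by simp
          then show False using inj_onD[OF inj', of j k] that k \<open>k < e\<close> by auto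
        qed
        with k show ?thesis by auto
      qed
      have "search_inv a b s4"
        unfolding search_inv_def Let_def
      proof (intro conjI allI impI ballI; (fold P'_def e'_def)?)
        show "reg s4 7 = (if b \<in> P' ` {..<reg s4 5} then 1 else 0)"
          using r4[of 7] r4[of 5] by (auto simp: s3 finished I)
      next
        fix w u assume "arr s4 3 w = Suc u"
        then show "u \<in> P' ` {..<reg s4 5}"
          using r4[of 5] a4[of 3] I(10) by (auto simp: s3 finished m2 split: if_splits)
      next
        fix i assume i: "i < e'"
        show "(a, P' i) \<in> co_adj\<^sup>*"
        proof (cases "i < e")
          case True
          then show ?thesis using I(11) P' by simp
        next
          case False
          with i have "P' i \<notin> nbs v" "P' i < n" using queued bij e4 by (auto simp: bij_betw_def)
          moreover have "P' i \<noteq> v"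
            using inj_onD[OF inj', of i h] P'[OF I(5)] i False e4 I(5) by (auto simp: v_def)
          ultimately have "(v, P' i) \<in> co_adj" using vn by (simp add: co_adj_def)
          with I(11)[OF I(5)] show ?thesis unfolding v_def by (rule rtrancl_into_rtrancl)
        qed
      next
        fix i j assume i: "i < reg s4 5" and j: "j \<in> {e'..<n}"
        show "P' j \<in> nbs (P' i)"
        proof (cases "i = h")
          case True
          then show ?thesis using rest[OF j] P'[OF I(5)] by (simp add: v_def)
        next
          case False
          with i have "i < h" using r4[of 5] by (simp add: s3)
          with rearranged[of j] I(12) j e4 P'[of i] I(5) show ?thesis by fastforce
        qed
      qed (use r4 a4 s3 I e4 bij P' in \<open>auto simp: e'_def P'_def\<close>)
      \<comment> \<open>The cells left behind hold distinct neighbours of \<open>v\<close>, so their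
        scan is charged to \<open>deg v\<close>; with the 4 per cell for marking this explains the
        13 in \<open>search_pot\<close>.\<close>
      moreover have "n - e' \<le> deg v"
      proof -
        have "n - e' = card (P' ` {e'..<n})"
          by (subst card_image) (auto intro: inj_on_subset[OF inj'])
        also have "\<dots> \<le> card (nbs v)"
          by (rule card_mono) (use rest in \<open>auto simp: nbs_def\<close>)
        finally show ?thesis using card_nbs_le le_trans by blast
      qed
      moreover have "(\<Sum>i<reg s4 5. deg (P' i)) = (\<Sum>i<h. deg (P i)) + deg v"
        using r4[of 5] P' I(5) by (simp add: s3 v_def)
      \<comment> \<open>Ensures that the truncated subtraction in \<open>search_pot\<close> really
        drops by \<open>deg v\<close>.\<close>
      moreover have "(\<Sum>i<h. deg (P i)) + deg v \<le> (\<Sum>v<n. deg v)"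
      proof -
        have "(\<Sum>i<h. deg (P i)) + deg v = (\<Sum>i<Suc h. deg (P i))" by (simp add: v_def)
        also have "\<dots> \<le> (\<Sum>i<n. deg (P i))" by (rule sum_mono2) (use I in auto)
        also have "\<dots> = (\<Sum>v<n. deg v)" using I(8) by (rule sum.reindex_bij_betw)
        finally show ?thesis .
      qed
      moreover have "n - h = Suc (n - Suc h)" using I by simp
      ultimately show "search_inv a b s4 \<and> 9 + (t2 + (1 + t4)) + search_pot s4 \<le> search_pot s"
        using t2 t4 e4 r4[of 5] s3 unfolding search_pot_def
        by (simp flip: defs P'_def e'_def)
    qed (use I in auto)
    then show "runs (Copy 9 6) s2 (\<lambda>t1 s1. runs scan_loop s1
      (\<lambda>t2a s'. search_inv a b s' \<and> 9 + (t2 + (t1 + t2a)) + search_pot s' \<le> search_pot s))"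
      by (simp add: s3_def)
  qed
qed

lemma runs_search_loop:
  assumes "search_inv a b s"
  shows "runs search_loop s (\<lambda>t s'. t \<le> 1 + search_pot s \<and> search_inv a b s' \<and>
    \<not> holds (TLess 5 6) s')"
  unfolding search_loop_def
proof (rule runs_While[where I = "search_inv a b", OF assms])
  fix s assume inv: "search_inv a b s" and "holds (TLess 5 6) s"
  then have "reg s 5 < reg s 6" by simp
  note step = search_step[OF inv this]
  have "reg s 3 = b" "arr s 0 = off" using inv by (auto simp: search_inv_def Let_def)
  then show "runs (Seq (Load 8 2 5) (Seq (Inc 5) (Seq (If (TEq 8 3) (Const 7 1) Skip)
     (Seq (Load 9 0 8) (Seq (Copy 11 8) (Seq (Inc 11) (Seq (Load 10 0 11)
     (Seq mark_loop (Seq (Copy 9 6) scan_loop))))))))) s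
     (\<lambda>t s'. search_inv a b s' \<and> 1 + t + search_pot s' \<le> search_pot s)"
    by (auto simp del: runs_Seq simp add: runs_Seq[of "Load _ _ _"] runs_Seq[of "Inc _"]
        runs_Seq[of "If _ _ _"] runs_Seq[of "Copy _ _"] intro!: runs_mono[OF step])
qed

text \<open>With \<open>h = e\<close> the finished vertices contain \<open>a\<close>, are reachable
  from \<open>a\<close> and are closed under \<open>co_adj\<close>; hence they form exactly the set
  reachable from \<open>a\<close>.\<close>

lemma search_inv_answer:
  assumes inv: "search_inv a b s" and "\<not> holds (TLess 5 6) s" and "b < n"
  shows "reg s 7 = (if (a, b) \<in> co_adj\<^sup>* then 1 else 0)"
proof -
  define P where "P = arr s 2"
  define h where "h = reg s 5"
  have I: "h \<le> n" "0 < h" "P 0 = a" "bij_betw P {..<n} {..<n}"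
    "reg s 7 = (if b \<in> P ` {..<h} then 1 else 0)"
    "\<And>i. i < h \<Longrightarrow> (a, P i) \<in> co_adj\<^sup>*"
    "\<And>i j. i < h \<Longrightarrow> j \<in> {h..<n} \<Longrightarrow> P j \<in> nbs (P i)"
    using assms(1,2) unfolding search_inv_def Let_def P_def h_def by auto
  have "w \<in> P ` {..<h}" if "(a, w) \<in> co_adj\<^sup>*" for w
    using that
  proof (induction rule: rtrancl_induct)
    case base
    then show ?case using I(2,3) by auto
  next
    case (step u w)
    then obtain i where i: "i < h" "u = P i" by auto
    from step have "w < n" "w \<notin> nbs u" by (auto simp: co_adj_def)
    moreover from \<open>w < n\<close> obtain j where "j < n" "w = P j"
      using I(4) by (auto simp: bij_betw_def)
    ultimately show ?case using I(7)[of i j] i by (cases "j < h") auto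
  qed
  with I(6) have "b \<in> P ` {..<h} \<longleftrightarrow> (a, b) \<in> co_adj\<^sup>*" by auto
  with I(5) show ?thesis by simp
qed

lemma runs_complement_search:
  assumes "reg s 0 = n" "reg s 1 = a" "reg s 3 = b" "reg s 5 = 0" "reg s 7 = 0"
    "arr s 0 = off" "arr s 1 = cells" "arr s 3 = (\<lambda>_. 0)" "a < n" "b < n"
  shows "runs complement_search s (\<lambda>t s'. t \<le> 7 + 24 * n + 13 * (off n - off 0) \<and>
    answers s' ((a, b) \<in> co_adj\<^sup>*))"
proof -
  have "runs (Seq (Const 5 0) (Seq (Store 2 1 5) (Seq (Store 2 5 1) (Seq (Const 6 1)
     (Seq search_loop (Copy 0 7)))))) s1 (\<lambda>t2 s'. t1 + t2 \<le> 7 + 24 * n + 13 * (off n - off 0) \<and>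
    answers s' ((a, b) \<in> co_adj\<^sup>*))"
    if t1: "t1 \<le> 1 + 3 * n" and r: "\<forall>x. x \<noteq> 5 \<longrightarrow> reg s1 x = reg s x"
      and ar: "\<forall>a. a \<noteq> 2 \<longrightarrow> arr s1 a = arr s a" and P: "\<forall>i<n. arr s1 2 i = i" for t1 s1
  proof -
    define s2 where "s2 = set_reg 6 1 (set_arr 2 0 a (set_arr 2 a 0 (set_reg 5 0 s1)))"
    have "bij_betw (arr s1 2) {..<n} {..<n}"
      using P by (subst bij_betw_cong[of _ _ id]) auto
    then have "bij_betw ((arr s1 2)(a := arr s1 2 0, 0 := arr s1 2 a)) {..<n} {..<n}"
      by (rule bij_betw_swap_values) (use assms in auto)
    moreover have "arr s2 2 = (arr s1 2)(a := arr s1 2 0, 0 := arr s1 2 a)"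
      using P assms by (simp add: s2_def)
    ultimately have "bij_betw (arr s2 2) {..<n} {..<n}" by simp
    then have inv: "search_inv a b s2"
      using r ar assms by (auto simp: search_inv_def Let_def s2_def)
    \<comment> \<open>Initially \<open>h = 0\<close> and \<open>e = 1\<close>: the potential is
      \<open>12 * n + 9 * (n - 1)\<close> plus 13 per cell, and \<open>a < n\<close> ensures that
      \<open>n\<close> is positive.\<close>
    have "off 0 + (\<Sum>v<n. deg v) = off n" by (rule sum_deg) simp
    then have pot: "search_pot s2 \<le> 21 * n + 13 * (off n - off 0) - 9"
      using assms(9) by (simp add: search_pot_def s2_def)
    have "runs (Seq search_loop (Copy 0 7)) s2
      (\<lambda>t s'. t1 + (4 + t) \<le> 7 + 24 * n + 13 * (off n - off 0) \<and> answers s' ((a, b) \<in> co_adj\<^sup>*))"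
      unfolding runs_Seq
      by (rule runs_mono[OF runs_search_loop[OF inv]])
        (use pot t1 \<open>b < n\<close> \<open>a < n\<close> in \<open>auto simp: answers_def search_inv_answer\<close>)
    then show ?thesis
      using r assms by (simp add: s2_def)
  qed
  then show ?thesis
    unfolding complement_search_def runs_Seq[of init_loop]
    by (intro runs_mono[OF runs_init_loop]) (use assms in auto)
qed

end


section \<open>Token jumping on two tokens\<close>

definition complement_arcs :: "'a pair_pre_digraph \<Rightarrow> 'a rel" where
  "complement_arcs G = {(u, v). u \<in> pverts G \<and> v \<in> pverts G \<and> u \<noteq> v \<and> (u, v) \<notin> parcs G}"

text \<open>Walks shorten to simple paths, which is what \<open>apath\<close> asks for, so only
  reachability matters from here on.\<close>

lemma token_jumping_iff_reachable:
  "(\<exists>p. token_jumping_transformation k G A p B) \<longleftrightarrow> A \<rightarrow>\<^sup>*\<^bsub>with_proj (config_graph k G)\<^esub> B"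
proof -
  interpret wf_digraph "with_proj (config_graph k G)"
    by unfold_locales (auto simp: config_graph_def Let_def)
  show ?thesis by (simp add: token_jumping_transformation_def reachable_apath)
qed

text \<open>The intersection is nonempty and a proper subset of \<open>I\<close>. Thus distinct
  configurations of two tokens are adjacent as soon as they share a vertex.\<close>

lemma card_2_inter_eq_1:
  assumes "card I = 2" "card J = 2" "I \<inter> J \<noteq> {}" "I \<noteq> J"
  shows "card (I \<inter> J) = 1"
proof -
  have fin: "finite I" "finite J" using assms card.infinite by fastforce+
  have "I \<inter> J \<noteq> I"
    using assms fin card_subset_eq[of J I] by auto
  then have "card (I \<inter> J) < card I" using fin by (intro psubset_card_mono) auto
  moreover have "card (I \<inter> J) > 0" using assms fin by (simp add: card_gt_0_iff)
  ultimately show ?thesis using assms by linarith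
qed

lemma card_pair_eq_2_iff: "card {u, v} = 2 \<longleftrightarrow> u \<noteq> v"
  by (cases "u = v") simp_all

context pair_graph
begin

lemma complement_arcs_sym: "(u, v) \<in> complement_arcs G \<Longrightarrow> (v, u) \<in> complement_arcs G"
  using pair_sym_arcs unfolding complement_arcs_def symmetric_def sym_def by auto

lemma config_vert_iff:
  "{u, v} \<in> pverts (config_graph 2 G) \<longleftrightarrow> (u, v) \<in> complement_arcs G"
proof -
  have "(w, w) \<notin> parcs G" for w using pair_no_loops by fastforce
  then have "independent_set G {u, v} \<longleftrightarrow>
      u \<in> pverts G \<and> v \<in> pverts G \<and> (u, v) \<notin> parcs G \<and> (v, u) \<notin> parcs G"
    by (simp add: independent_set_def)
  moreover have "(u, v) \<in> parcs G \<longleftrightarrow> (v, u) \<in> parcs G"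
    using pair_sym_arcs unfolding symmetric_def by (auto dest: symD)
  ultimately show ?thesis
    by (simp add: config_graph_def complement_arcs_def card_pair_eq_2_iff) blast
qed

text \<open>The reflexive closure also covers \<open>x = y\<close>, so a token that stays put needs
  no separate treatment along a transformation.\<close>

lemma config_vert_complement:
  assumes "I \<in> pverts (config_graph 2 G)" "x \<in> I" "y \<in> I"
  shows "(x, y) \<in> (complement_arcs G)\<^sup>*"
proof (cases "x = y")
  case False
  have "card I = 2" using assms by (simp add: config_graph_def Let_def)
  with assms False have "I = {x, y}" by (auto simp: card_2_iff)
  with assms show ?thesis using config_vert_iff by blast
qed simp

text \<open>Consecutive configurations share a vertex \<open>z\<close>: the path so far leads from
  \<open>x\<close> to \<open>z\<close>, and inside the new configuration one gets from
  \<open>z\<close> to \<open>y\<close>.\<close>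

lemma config_reachable_imp_complement_reachable:
  assumes "I \<rightarrow>\<^sup>*\<^bsub>with_proj (config_graph 2 G)\<^esub> J" "x \<in> I" "y \<in> J"
  shows "(x, y) \<in> (complement_arcs G)\<^sup>*"
proof -
  have I: "I \<in> pverts (config_graph 2 G)"
    using assms(1) by (auto elim: reachable_in_vertsE)
  have "(I, J) \<in> (parcs (config_graph 2 G))\<^sup>*"
    using reachable_rtranclI[OF assms(1)] by simp
  then show ?thesis using \<open>y \<in> J\<close>
  proof (induction arbitrary: y rule: rtrancl_induct)
    case base
    then show ?case using config_vert_complement[OF I assms(2)] by simp
  next
    case (step J K)
    then have "card (J \<inter> K) = 1" and K: "K \<in> pverts (config_graph 2 G)"
      by (auto simp: config_graph_def Let_def)
    then obtain z where z: "z \<in> J" "z \<in> K" by (metis IntE card_1_singletonE singletonI)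
    have "(x, z) \<in> (complement_arcs G)\<^sup>*" using step.IH z(1) .
    also have "(z, y) \<in> (complement_arcs G)\<^sup>*"
      using config_vert_complement[OF K z(2) step.prems] .
    finally show ?case .
  qed
qed

text \<open>The token on \<open>x\<close> stays while the other jumps from \<open>y\<close> to
  \<open>z\<close>. If the two configurations coincide there is no arc to use, but nothing has to be
  done.\<close>

lemma config_step:
  assumes "(x, y) \<in> complement_arcs G" "(x, z) \<in> complement_arcs G"
    and "I \<rightarrow>\<^sup>*\<^bsub>with_proj (config_graph 2 G)\<^esub> {x, y}"
  shows "I \<rightarrow>\<^sup>*\<^bsub>with_proj (config_graph 2 G)\<^esub> {x, z}"
proof (cases "{x, y} = {x, z}")
  case False
  interpret C: wf_digraph "with_proj (config_graph 2 G)"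
    by unfold_locales (auto simp: config_graph_def Let_def)
  have v: "{x, y} \<in> pverts (config_graph 2 G)" "{x, z} \<in> pverts (config_graph 2 G)"
    using assms config_vert_iff by auto
  then have "card ({x, y} \<inter> {x, z}) = 1"
    using False by (intro card_2_inter_eq_1) (auto simp: config_graph_def Let_def)
  with v have "({x, y}, {x, z}) \<in> parcs (config_graph 2 G)"
    by (auto simp: config_graph_def Let_def)
  then show ?thesis using C.reachable_adj_trans[OF assms(3)] by simp
qed (use assms in simp)

text \<open>The tokens are led along the edges of a complement path. The partner \<open>b'\<close>
  stays arbitrary in the induction, so that it can be taken as the next vertex of the path before
  pivoting there.\<close>

lemma complement_reachable_imp_config_reachable:
  assumes "(a, b) \<in> (complement_arcs G)\<^sup>*" "(a, a') \<in> complement_arcs G"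
    "(b, b') \<in> complement_arcs G"
  shows "{a, a'} \<rightarrow>\<^sup>*\<^bsub>with_proj (config_graph 2 G)\<^esub> {b, b'}"
  using assms
proof (induction arbitrary: b' rule: rtrancl_induct)
  case base
  interpret C: wf_digraph "with_proj (config_graph 2 G)"
    by unfold_locales (auto simp: config_graph_def Let_def)
  have "{a, a'} \<in> pverts (config_graph 2 G)" using base config_vert_iff by auto
  then have "{a, a'} \<rightarrow>\<^sup>*\<^bsub>with_proj (config_graph 2 G)\<^esub> {a, a'}" by simp
  then show ?case by (rule config_step[OF base])
next
  case (step x z)
  have zx: "(z, x) \<in> complement_arcs G" using step.hyps(2) by (rule complement_arcs_sym)
  have "{a, a'} \<rightarrow>\<^sup>*\<^bsub>with_proj (config_graph 2 G)\<^esub> {x, z}"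
    using step.IH[OF step.prems(1) step.hyps(2)] .
  then have "{a, a'} \<rightarrow>\<^sup>*\<^bsub>with_proj (config_graph 2 G)\<^esub> {z, x}"
    by (simp add: insert_commute)
  then show ?case by (rule config_step[OF zx step.prems(2)])
qed

lemma token_jumping_2_iff:
  assumes "(a1, a2) \<in> complement_arcs G" "(b1, b2) \<in> complement_arcs G"
  shows "(\<exists>p. token_jumping_transformation 2 G {a1, a2} p {b1, b2}) \<longleftrightarrow>
    (a1, b1) \<in> (complement_arcs G)\<^sup>*"
  unfolding token_jumping_iff_reachable
proof
  assume "{a1, a2} \<rightarrow>\<^sup>*\<^bsub>with_proj (config_graph 2 G)\<^esub> {b1, b2}"
  then show "(a1, b1) \<in> (complement_arcs G)\<^sup>*"
    by (rule config_reachable_imp_complement_reachable) simp_all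
qed (rule complement_reachable_imp_config_reachable[OF _ assms])

end

text \<open>The arcs are covered by the fibres over the edges, and the fibre over
  \<open>{u, v}\<close> lies in \<open>{(u, v), (v, u)}\<close>.\<close>

lemma (in pair_fin_digraph) card_parcs_le: "card (parcs G) \<le> 2 * card (uedges G)"
proof -
  have fin: "finite (uedges G)"
  proof (rule finite_subset)
    show "uedges G \<subseteq> (\<lambda>(u, v). {u, v}) ` parcs G" by (auto simp: uedges_def)
  qed (use pair_finite_arcs in simp)
  have sub: "parcs G \<subseteq> (\<Union>e\<in>uedges G. {p. {fst p, snd p} = e})"
    by (fastforce simp: uedges_def)
  have fib: "finite {p. {fst p, snd p} = e} \<and> card {p. {fst p, snd p} = e} \<le> 2"
    if e: "e \<in> uedges G" for e
  proof -
    obtain u v where "e = {u, v}" using e by (auto simp: uedges_def)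
    then have sub: "{p. {fst p, snd p} = e} \<subseteq> {(u, v), (v, u)}"
      by (auto simp: doubleton_eq_iff)
    have "card {p, q} \<le> 2" for p q :: "'a \<times> 'a" by (simp add: card_insert_if)
    with sub have "card {p. {fst p, snd p} = e} \<le> 2"
      by (meson card_mono finite.emptyI finite_insert le_trans)
    then show ?thesis
      using finite_subset[OF sub] by simp
  qed
  have "card (parcs G) \<le> card (\<Union>e\<in>uedges G. {p. {fst p, snd p} = e})"
    by (rule card_mono[OF _ sub]) (use fin fib in blast)
  also have "\<dots> \<le> (\<Sum>e\<in>uedges G. card {p. {fst p, snd p} = e})"
    by (rule card_UN_le[OF fin])
  also have "\<dots> \<le> (\<Sum>e\<in>uedges G. 2)" by (rule sum_mono) (use fib in blast)
  finally show ?thesis by simp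
qed

section \<open>Adjacency lists as segments of an array\<close>

lemma sum_list_map_length_take_Suc:
  "v < length xss \<Longrightarrow> sum_list (map length (take (Suc v) xss)) =
     sum_list (map length (take v xss)) + length (xss ! v)"
  by (simp add: take_Suc_conv_app_nth)

text \<open>Splitting \<open>concat xss\<close> around \<open>xss ! v\<close> shows that this list
  starts at the total length of its predecessors.\<close>

lemma concat_nth_image:
  assumes "v < length xss"
  shows "(\<lambda>i. concat xss ! i) ` {sum_list (map length (take v xss))..<
      sum_list (map length (take (Suc v) xss))} = set (xss ! v)"
proof -
  define k where "k = sum_list (map length (take v xss))"
  have k: "length (concat (take v xss)) = k" by (simp add: k_def length_concat)
  have split: "concat xss = concat (take v xss) @ xss ! v @ concat (drop (Suc v) xss)"
    using assms by (metis concat.simps(2) concat_append id_take_nth_drop)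
  have nth: "concat xss ! (k + i) = xss ! v ! i" if "i < length (xss ! v)" for i
    using that by (subst split) (simp add: nth_append k)
  have "(!) (concat xss) ` {k..<k + length (xss ! v)} =
      (!) (concat xss) ` (+) k ` {0..<length (xss ! v)}"
    by (simp add: add.commute)
  also have "\<dots> = (!) (xss ! v) ` {0..<length (xss ! v)}"
    unfolding image_image by (intro image_cong) (simp_all add: nth)
  also have "\<dots> = set (xss ! v)"
    by (simp add: nth_image)
  finally show ?thesis
    unfolding sum_list_map_length_take_Suc[OF assms] k_def .
qed

text \<open>The arcs are counted by their tails; distinctness turns the length of each list into the
  number of neighbours.\<close>

lemma sum_list_length_adjacency_lists:
  assumes "pair_graph G" "adjacency_lists G adj"
  shows "sum_list (map length adj) = card (parcs G)"
proof -
  interpret pair_graph G by fact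
  have V: "pverts G = {..<length adj}"
    and nb: "\<And>v. v < length adj \<Longrightarrow> distinct (adj ! v) \<and> set (adj ! v) = {w. (v, w) \<in> parcs G}"
    using assms(2) by (auto simp: adjacency_lists_def)
  have "parcs G = Sigma {..<length adj} (\<lambda>v. set (adj ! v))"
    using nb V by (auto dest: in_arcsD1)
  then have "card (parcs G) = (\<Sum>v<length adj. card (set (adj ! v)))" by simp
  also have "\<dots> = (\<Sum>v<length adj. length (adj ! v))"
    by (rule sum.cong) (auto intro!: distinct_card dest: nb)
  also have "\<dots> = sum_list (map length adj)"
    by (simp add: sum_list_sum_nth atLeast0LessThan)
  finally show ?thesis ..
qed

theorem mainTheorem5:
  shows "\<exists>(P :: com) (c :: nat).
    \<forall>(G :: nat pair_pre_digraph) (adj :: nat list list) (a1 :: nat) (a2 :: nat) (b1 :: nat) (b2 :: nat).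
      pair_graph G \<longrightarrow> adjacency_lists G adj \<longrightarrow>
      independent_set G {a1, a2} \<longrightarrow> card {a1, a2} = 2 \<longrightarrow>
      independent_set G {b1, b2} \<longrightarrow> card {b1, b2} = 2 \<longrightarrow>
      (\<exists>t s'. exec P (input_state adj (a1, a2) (b1, b2)) t s' \<and>
              t \<le> c * (card (pverts G) + card (uedges G)) \<and>
              answers s' (\<exists>p. token_jumping_transformation 2 G {a1, a2} p {b1, b2}))"
\<comment> \<open>The constant 31 absorbs \<open>7 + 24 * n\<close>, because \<open>n\<close> is at
  least 1, and the factor \<open>13 * 2 = 26\<close> of the number of edges.\<close>
proof (rule exI[of _ complement_search], rule exI[of _ 31], intro allI impI)
  fix G :: "nat pair_pre_digraph" and adj a1 a2 b1 b2
  assume G: "pair_graph G" and adj: "adjacency_lists G adj"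
    and "independent_set G {a1, a2}" "card {a1, a2} = 2"
    and "independent_set G {b1, b2}" "card {b1, b2} = 2"
  then have ab: "(a1, a2) \<in> complement_arcs G" "(b1, b2) \<in> complement_arcs G"
    by (simp_all add: independent_set_def complement_arcs_def card_pair_eq_2_iff)
  interpret pair_graph G by fact
  let ?s = "input_state adj (a1, a2) (b1, b2)"
  define n where "n = length adj"
  have V: "pverts G = {..<n}"
    and nb: "\<And>v. v < n \<Longrightarrow> set (adj ! v) = {w. (v, w) \<in> parcs G}"
    using adj by (auto simp: adjacency_lists_def n_def)
  have off: "arr ?s 0 v = sum_list (map length (take v adj))" if "v \<le> n" for v
    using that by (simp add: input_state_def n_def)
  interpret A: adjacency_arrays n "arr ?s 0" "arr ?s 1"
    by unfold_locales (simp add: off n_def sum_list_map_length_take_Suc)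
  have "A.nbs v = {w. (v, w) \<in> parcs G}" if "v < n" for v
  proof -
    \<comment> \<open>Every segment ends within the concatenated lists, so the default 0 of array 1
      is never read as a neighbour.\<close>
    have "arr ?s 0 (Suc v) \<le> arr ?s 0 n"
      using that off[of "Suc v"] off[of n]
      by (metis append_take_drop_id le_add1 map_append n_def order_refl sum_list_append take_all
          Suc_leI)
    then have "A.nbs v = (\<lambda>i. concat adj ! i) ` {arr ?s 0 v..<arr ?s 0 (Suc v)}"
      unfolding A.nbs_def
      by (intro image_cong) (auto simp: off n_def input_state_def length_concat)
    also have "\<dots> = set (adj ! v)"
      using that concat_nth_image[of v adj] by (simp add: off n_def)
    finally show ?thesis using nb that by simp
  qed
  then have "A.co_adj = complement_arcs G"
    unfolding A.co_adj_def complement_arcs_def V by auto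
  then have iff: "(\<exists>p. token_jumping_transformation 2 G {a1, a2} p {b1, b2}) \<longleftrightarrow>
      (a1, b1) \<in> A.co_adj\<^sup>*"
    using token_jumping_2_iff[OF ab] by simp
  have "a1 < n" "b1 < n" using ab V by (auto simp: complement_arcs_def)
  then have run: "runs complement_search ?s (\<lambda>t s'. t \<le> 7 + 24 * n + 13 * (arr ?s 0 n - arr ?s 0 0) \<and>
      answers s' ((a1, b1) \<in> A.co_adj\<^sup>*))"
    by (intro A.runs_complement_search) (auto simp: input_state_def n_def)
  have "arr ?s 0 n - arr ?s 0 0 \<le> 2 * card (uedges G)"
    using off[of n] sum_list_length_adjacency_lists[OF G adj] card_parcs_le by (simp add: n_def)
  then have "7 + 24 * n + 13 * (arr ?s 0 n - arr ?s 0 0) \<le> 31 * (card (pverts G) + card (uedges G))"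
    using \<open>a1 < n\<close> by (simp add: V)
  with run show "\<exists>t s'. exec complement_search ?s t s' \<and>
      t \<le> 31 * (card (pverts G) + card (uedges G)) \<and>
      answers s' (\<exists>p. token_jumping_transformation 2 G {a1, a2} p {b1, b2})"
    unfolding iff runs_def by (meson le_trans)
qed

end
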